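(* Let $A\subset\mathbb{R}^2$ be compact, $\Omega\subset\mathbb{R}^2$ open, $C_0\ge 0$, and let $f$ be a finite (signed) Radon measure on $A$. Assume that for any positive (i.e. nonnegative) Lipschitz function $\xi$ in $\mathrm{Lip}_\Omega(A)$, $$\int\xi\,df\ge-C_0|\nabla\xi|_{L^\infty(A)}.$$ Then there exists a Radon measure $g$ on $A$ such that $0\le g\le f_+$ and such that $$\|f-g\|_{\mathrm{Lip}_\Omega(A)^*}\le C_0.$$
   Context: $f_+$ and $f_-$ denote the positive and negative parts of a measure $f$ (both positive measures); $f\le g$ means that $g-f$ is a positive measure. $\mathrm{Lip}_\Omega(A)$ denotes the set of Lipschitz functions on $A$ which vanish on $A\setminus\Omega$, and $$\|f\|_{\mathrm{Lip}_\Omega(A)^*}=\sup\Big\{\int\xi\,df:\ \xi\in\mathrm{Lip}_\Omega(A),\ |\nabla\xi|_{L^\infty(A)}\le1\Big\}.$$ For a Lipschitz function $\xi$ on $A$, $|\nabla\xi|_{L^\infty(A)}$ is understood as the Lipschitz constant of $\xi$ on $A$ (these agree when $A$ is, e.g., a closed ball). *)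

theory Defs
  imports "HOL-Analysis.Analysis"
begin

(* A finite signed Borel measure on A is a real-valued, countably additive set function on the
   Borel subsets of A; its values on other sets are irrelevant.  On a compact subset of the plane
   every finite Borel measure is regular, so that these are exactly the finite signed Radon
   measures on A. *)

abbreviation borel_sets_on :: "'a::topological_space set \<Rightarrow> 'a set set" where
  "borel_sets_on A \<equiv> sets (restrict_space borel A)"

definition signed_measure_on :: "'a::topological_space set \<Rightarrow> ('a set \<Rightarrow> real) \<Rightarrow> bool" where
  "signed_measure_on A f \<longleftrightarrow>
     f {} = 0 \<and>
     (\<forall>F :: nat \<Rightarrow> 'a set. range F \<subseteq> borel_sets_on A \<longrightarrow> disjoint_family F \<longrightarrow>
        (\<lambda>i. f (F i)) sums f (\<Union>i. F i))"

definition positive_measure_on :: "'a::topological_space set \<Rightarrow> ('a set \<Rightarrow> real) \<Rightarrow> bool" where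
  "positive_measure_on A f \<longleftrightarrow> signed_measure_on A f \<and> (\<forall>B \<in> borel_sets_on A. 0 \<le> f B)"

definition measure_le_on ::
    "'a::topological_space set \<Rightarrow> ('a set \<Rightarrow> real) \<Rightarrow> ('a set \<Rightarrow> real) \<Rightarrow> bool" where
  "measure_le_on A f g \<longleftrightarrow> positive_measure_on A (\<lambda>B. g B - f B)"

(* Jordan decomposition.  The suprema are over nonempty sets (take C empty) that are bounded,
   because a real-valued signed measure is bounded. *)

definition pos_part_on ::
    "'a::topological_space set \<Rightarrow> ('a set \<Rightarrow> real) \<Rightarrow> 'a set \<Rightarrow> real" where
  "pos_part_on A f B = (SUP C \<in> {C \<in> borel_sets_on A. C \<subseteq> B}. f C)"

definition neg_part_on ::
    "'a::topological_space set \<Rightarrow> ('a set \<Rightarrow> real) \<Rightarrow> 'a set \<Rightarrow> real" where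
  "neg_part_on A f B = (SUP C \<in> {C \<in> borel_sets_on A. C \<subseteq> B}. - f C)"

(* Only used for positive measures: measure_of returns the zero measure if the given set function
   is not countably additive, and ennreal truncates negative values to 0. *)

definition to_measure_on :: "'a::topological_space set \<Rightarrow> ('a set \<Rightarrow> real) \<Rightarrow> 'a measure" where
  "to_measure_on A f = measure_of A (borel_sets_on A) (\<lambda>B. ennreal (f B))"

definition signed_integral_on ::
    "'a::topological_space set \<Rightarrow> ('a set \<Rightarrow> real) \<Rightarrow> ('a \<Rightarrow> real) \<Rightarrow> real" where
  "signed_integral_on A f \<xi> =
     (LINT x|to_measure_on A (pos_part_on A f). \<xi> x) -
     (LINT x|to_measure_on A (neg_part_on A f). \<xi> x)"

(* Functions on A are represented by functions on the whole type; only their values on A matter. *)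

definition Lip_vanishing :: "'a::metric_space set \<Rightarrow> 'a set \<Rightarrow> ('a \<Rightarrow> real) set" where
  "Lip_vanishing \<Omega> A = {\<xi>. (\<exists>L. L-lipschitz_on A \<xi>) \<and> (\<forall>x \<in> A - \<Omega>. \<xi> x = 0)}"

definition lip_const :: "'a::metric_space set \<Rightarrow> ('a \<Rightarrow> real) \<Rightarrow> real" where
  "lip_const A \<xi> = Inf {L. L-lipschitz_on A \<xi>}"

(* Extended-real valued: the supremum can be infinite, for instance when A is contained in
   \<Omega> and f does not have total mass zero. *)

definition Lip_dual_norm :: "'a::metric_space set \<Rightarrow> 'a set \<Rightarrow> ('a set \<Rightarrow> real) \<Rightarrow> ereal" where
  "Lip_dual_norm \<Omega> A f =
     (SUP \<xi> \<in> {\<xi> \<in> Lip_vanishing \<Omega> A. lip_const A \<xi> \<le> 1}. ereal (signed_integral_on A f \<xi>))"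

end

theory Submission
  imports Defs
begin

text \<open>
  Decomposing a Lipschitz function \<open>\<xi>\<close> as \<open>\<xi>\<^sub>+ - \<xi>\<^sub>-\<close> and applying the hypothesis to \<open>\<xi>\<^sub>-\<close>, whose
  Lipschitz constant is at most that of \<open>\<xi>\<close>, gives
  \<open>\<integral>\<xi> df \<le> C\<^sub>0 |\<nabla>\<xi>| + \<integral>\<xi>\<^sub>+ df\<^sub>+\<close>. The right-hand side is a sum of two sublinear functionals, so
  by the Hahn-Banach theorem the left-hand side splits as a sum of two linear functionals, one
  below \<open>C\<^sub>0 |\<nabla>\<xi>|\<close> and the other, \<open>G\<close>, below \<open>\<integral>\<phi>\<^sub>+ df\<^sub>+\<close> for every bounded Borel function \<open>\<phi>\<close>. The
  latter bound makes \<open>B \<mapsto> G(1\<^sub>B)\<close> a measure \<open>g\<close> with \<open>0 \<le> g \<le> f\<^sub>+\<close>: countable additivity is inherited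
  from \<open>f\<^sub>+\<close>.
\<close>

section \<open>Linear and sublinear functionals\<close>

text \<open>A linear subspace of the real functions, given as a carrier set: its later members are
  constrained on \<open>A\<close> only, and the values of a functional off the carrier are
  irrelevant.\<close>

definition function_space :: "('a \<Rightarrow> real) set \<Rightarrow> bool" where
  "function_space V \<longleftrightarrow> (\<lambda>_. 0) \<in> V \<and>
     (\<forall>x\<in>V. \<forall>y\<in>V. (\<lambda>i. x i + y i) \<in> V) \<and> (\<forall>x\<in>V. \<forall>c. (\<lambda>i. c * x i) \<in> V)"

text \<open>Homogeneity is asked as an inequality for positive \<open>c\<close>, a form that is
  direct to verify for infima and integrals; scaling back by \<open>inverse c\<close> turns it into
  equality.\<close>

definition sublinear_on :: "('a \<Rightarrow> real) set \<Rightarrow> (('a \<Rightarrow> real) \<Rightarrow> real) \<Rightarrow> bool" where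
  "sublinear_on V p \<longleftrightarrow>
     (\<forall>x\<in>V. \<forall>y\<in>V. p (\<lambda>i. x i + y i) \<le> p x + p y) \<and>
     (\<forall>x\<in>V. \<forall>c>0. p (\<lambda>i. c * x i) \<le> c * p x)"

definition linear_functional_on :: "('a \<Rightarrow> real) set \<Rightarrow> (('a \<Rightarrow> real) \<Rightarrow> real) \<Rightarrow> bool" where
  "linear_functional_on V G \<longleftrightarrow>
     (\<forall>x\<in>V. \<forall>y\<in>V. G (\<lambda>i. x i + y i) = G x + G y) \<and>
     (\<forall>x\<in>V. \<forall>c. G (\<lambda>i. c * x i) = c * G x)"

lemma function_space_zero: "function_space V \<Longrightarrow> (\<lambda>_. 0) \<in> V"
  and function_space_add:
    "function_space V \<Longrightarrow> x \<in> V \<Longrightarrow> y \<in> V \<Longrightarrow> (\<lambda>i. x i + y i) \<in> V"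
  and function_space_scale: "function_space V \<Longrightarrow> x \<in> V \<Longrightarrow> (\<lambda>i. c * x i) \<in> V"
  by (auto simp: function_space_def)

lemma function_space_minus:
  "function_space V \<Longrightarrow> x \<in> V \<Longrightarrow> (\<lambda>i. - x i) \<in> V"
  using function_space_scale[of V x "-1"] by simp

lemma function_space_diff:
  "function_space V \<Longrightarrow> x \<in> V \<Longrightarrow> y \<in> V \<Longrightarrow> (\<lambda>i. x i - y i) \<in> V"
  using function_space_add[of V x "\<lambda>i. - y i"] function_space_minus[of V y] by simp

lemma sublinear_on_add:
  "sublinear_on V p \<Longrightarrow> x \<in> V \<Longrightarrow> y \<in> V \<Longrightarrow> p (\<lambda>i. x i + y i) \<le> p x + p y"
  by (simp add: sublinear_on_def)

lemma sublinear_on_scale_le: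
  "sublinear_on V p \<Longrightarrow> x \<in> V \<Longrightarrow> 0 < c \<Longrightarrow> p (\<lambda>i. c * x i) \<le> c * p x"
  by (simp add: sublinear_on_def)

lemma sublinear_on_zero:
  assumes "function_space V" "sublinear_on V p"
  shows "p (\<lambda>_. 0) = 0"
proof -
  have *: "p (\<lambda>_. 0) \<le> c * p (\<lambda>_. 0)" if "0 < c" for c
    using sublinear_on_scale_le[OF assms(2) function_space_zero[OF assms(1)] that] by simp
  \<comment> \<open>The factor 2 gives \<open>0 \<le> p (\<lambda>_. 0)\<close>, the factor 1/2
    gives the reverse.\<close>
  show ?thesis using *[of 2] *[of "1/2"] by simp
qed

lemma sublinear_on_scale:
  assumes "function_space V" "sublinear_on V p" "x \<in> V" "0 \<le> c"
  shows "p (\<lambda>i. c * x i) = c * p x"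
proof (cases "c = 0")
  case True
  then show ?thesis using sublinear_on_zero[OF assms(1,2)] by simp
next
  case False
  then have c: "0 < c" using assms by simp
  let ?y = "\<lambda>i. c * x i"
  have 1: "p ?y \<le> c * p x" using assms(2,3) c by (rule sublinear_on_scale_le)
  have "?y \<in> V" using assms function_space_scale by blast
  then have "p (\<lambda>i. inverse c * ?y i) \<le> inverse c * p ?y"
    using c by (intro sublinear_on_scale_le[OF assms(2)]) auto
  moreover have "(\<lambda>i. inverse c * ?y i) = x" using c by (auto simp: field_simps)
  ultimately have "c * p x \<le> p ?y" using c by (simp add: field_simps)
  with 1 show ?thesis by simp
qed

text \<open>Subadditivity applied to \<open>y = (x + y) + (- x)\<close>. Lower bounds of this shape
  keep the infima formed below finite.\<close>

lemma sublinear_on_lower: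
  assumes "function_space V" "sublinear_on V p" "x \<in> V" "y \<in> V"
  shows "p y - p (\<lambda>i. - x i) \<le> p (\<lambda>i. x i + y i)"
proof -
  have "p (\<lambda>i. (x i + y i) + - x i) \<le> p (\<lambda>i. x i + y i) + p (\<lambda>i. - x i)"
    using assms by (intro sublinear_on_add[where V = V] function_space_add function_space_minus)
  then show ?thesis by (simp add: algebra_simps)
qed

lemma sublinear_on_lower_minus:
  assumes "function_space V" "sublinear_on V p" "x \<in> V"
  shows "- p (\<lambda>i. - x i) \<le> p x"
  using sublinear_on_lower[OF assms function_space_zero[OF assms(1)]]
    sublinear_on_zero[OF assms(1,2)] by simp

lemma linear_functional_on_diff:
  "linear_functional_on V I \<Longrightarrow> linear_functional_on V J \<Longrightarrow>
    linear_functional_on V (\<lambda>\<phi>. I \<phi> - J \<phi>)"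
  by (simp add: linear_functional_on_def algebra_simps)

lemma linear_functional_on_add:
  "linear_functional_on V I \<Longrightarrow> x \<in> V \<Longrightarrow> y \<in> V \<Longrightarrow> I (\<lambda>i. x i + y i) = I x + I y"
  and linear_functional_on_scale:
  "linear_functional_on V I \<Longrightarrow> x \<in> V \<Longrightarrow> I (\<lambda>i. c * x i) = c * I x"
  by (simp_all add: linear_functional_on_def)

lemma linear_functional_on_minus:
  "linear_functional_on V I \<Longrightarrow> x \<in> V \<Longrightarrow> I (\<lambda>i. - x i) = - I x"
  using linear_functional_on_scale[of V I x "-1"] by simp

lemma linear_functional_on_sub:
  "function_space V \<Longrightarrow> linear_functional_on V I \<Longrightarrow> x \<in> V \<Longrightarrow> y \<in> V \<Longrightarrow>
    I (\<lambda>i. x i - y i) = I x - I y"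
  using linear_functional_on_add[of V I x "\<lambda>i. - y i"]
  by (simp add: linear_functional_on_minus function_space_minus)

lemma linear_functional_on_zero:
  "function_space V \<Longrightarrow> linear_functional_on V I \<Longrightarrow> I (\<lambda>_. 0) = 0"
  using linear_functional_on_scale[of V I "\<lambda>_. 0" 0] function_space_zero[of V] by simp

lemma linear_functional_on_sum:
  assumes "function_space V" "linear_functional_on V I" "finite S" "\<And>k. k \<in> S \<Longrightarrow> x k \<in> V"
  shows "(\<lambda>i. \<Sum>k\<in>S. c k * x k i) \<in> V \<and> I (\<lambda>i. \<Sum>k\<in>S. c k * x k i) = (\<Sum>k\<in>S. c k * I (x k))"
  using assms(3,4)
proof (induction S rule: finite_induct)
  case empty
  then show ?case
    using assms(1,2) by (simp add: function_space_zero linear_functional_on_zero)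
next
  case (insert k S)
  then have "(\<lambda>i. c k * x k i) \<in> V" using assms(1) by (intro function_space_scale) auto
  moreover have "(\<lambda>i. \<Sum>k\<in>S. c k * x k i) \<in> V" using insert by blast
  ultimately have "(\<lambda>i. c k * x k i + (\<Sum>k\<in>S. c k * x k i)) \<in> V"
    and "I (\<lambda>i. c k * x k i + (\<Sum>k\<in>S. c k * x k i)) = c k * I (x k) + (\<Sum>k\<in>S. c k * I (x k))"
    using insert linear_functional_on_add[OF assms(2)] linear_functional_on_scale[OF assms(2)]
    by (simp_all add: function_space_add[OF assms(1)])
  then show ?case using insert by simp
qed

section \<open>Minimal sublinear functionals and the Hahn-Banach theorem\<close>

lemma sublinear_on_Inf_chain:
  assumes V: "function_space V" and ne: "C \<noteq> {}"
    and sub: "\<And>p. p \<in> C \<Longrightarrow> sublinear_on V p"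
    and chain: "\<And>p q. p \<in> C \<Longrightarrow> q \<in> C \<Longrightarrow> (\<forall>x\<in>V. p x \<le> q x) \<or> (\<forall>x\<in>V. q x \<le> p x)"
    and bdd: "\<And>x. x \<in> V \<Longrightarrow> bdd_below ((\<lambda>p. p x) ` C)"
  shows "sublinear_on V (\<lambda>x. INF p\<in>C. p x)"
  unfolding sublinear_on_def
proof (intro conjI ballI allI impI)
  fix x y assume x: "x \<in> V" and y: "y \<in> V"
  have xy: "(\<lambda>i. x i + y i) \<in> V" using V x y by (rule function_space_add)
  let ?u = "INF p\<in>C. p (\<lambda>i. x i + y i)"
  \<comment> \<open>An infimum of sublinear functionals need not be subadditive. In a chain, the
    smaller of \<open>p\<close> and \<open>q\<close> is at most \<open>p\<close> at \<open>x\<close>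
    and at most \<open>q\<close> at \<open>y\<close>, so one member \<open>r\<close> serves both
    arguments.\<close>
  have *: "?u \<le> p x + q y" if p: "p \<in> C" and q: "q \<in> C" for p q
  proof -
    obtain r where r: "r \<in> C" "r x \<le> p x" "r y \<le> q y"
      using chain[OF p q] p q x y by (metis order_refl)
    have "?u \<le> r (\<lambda>i. x i + y i)" by (rule cINF_lower[OF bdd[OF xy] r(1)])
    also have "\<dots> \<le> r x + r y" using sublinear_on_add[OF sub[OF r(1)] x y] .
    finally show ?thesis using r by simp
  qed
  have "?u - q y \<le> (INF p\<in>C. p x)" if "q \<in> C" for q
    using *[OF _ that] by (intro cINF_greatest[OF ne]) (simp add: algebra_simps)
  then have "?u - (INF p\<in>C. p x) \<le> (INF p\<in>C. p y)"
    by (intro cINF_greatest[OF ne]) (simp add: algebra_simps)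
  then show "?u \<le> (INF p\<in>C. p x) + (INF p\<in>C. p y)" by simp
next
  fix x and c :: real assume x: "x \<in> V" and c: "0 < c"
  have cx: "(\<lambda>i. c * x i) \<in> V" using V x by (rule function_space_scale)
  have "(INF p\<in>C. p (\<lambda>i. c * x i)) / c \<le> (INF p\<in>C. p x)"
  proof (rule cINF_greatest[OF ne])
    fix p assume p: "p \<in> C"
    have "(INF p\<in>C. p (\<lambda>i. c * x i)) \<le> p (\<lambda>i. c * x i)" by (rule cINF_lower[OF bdd[OF cx] p])
    also have "\<dots> = c * p x" using V sub[OF p] x c by (simp add: sublinear_on_scale)
    finally show "(INF p\<in>C. p (\<lambda>i. c * x i)) / c \<le> p x" using c by (simp add: field_simps)
  qed
  then show "(INF p\<in>C. p (\<lambda>i. c * x i)) \<le> c * (INF p\<in>C. p x)" using c by (simp add: field_simps)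
qed

text \<open>The expression under the infimum is at least \<open>- p (- x)\<close>, because
  \<open>p (t * a) = t * p a\<close> for \<open>t \<ge> 0\<close>. Step lengths \<open>t\<close> for
  \<open>x\<close> and \<open>s\<close> for \<open>y\<close> combine to \<open>t + s\<close> for the
  sum, and \<open>t\<close> for \<open>x\<close> becomes \<open>c * t\<close> for
  \<open>c * x\<close>.\<close>

lemma sublinear_on_directional:
  assumes V: "function_space V" and p: "sublinear_on V p" and a: "a \<in> V"
  defines "p' \<equiv> \<lambda>x. INF t\<in>{0..}. p (\<lambda>i. x i + t * a i) - t * p a"
  shows "sublinear_on V p'"
    and "\<And>x t. x \<in> V \<Longrightarrow> 0 \<le> t \<Longrightarrow> p' x \<le> p (\<lambda>i. x i + t * a i) - t * p a"
proof -
  have ta: "(\<lambda>i. t * a i) \<in> V" for t using V a by (rule function_space_scale)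
  show le: "p' x \<le> p (\<lambda>i. x i + t * a i) - t * p a" if x: "x \<in> V" and t: "0 \<le> t" for x t
    unfolding p'_def
  proof (rule cINF_lower)
    show "bdd_below ((\<lambda>t. p (\<lambda>i. x i + t * a i) - t * p a) ` {0..})"
    proof (rule bdd_belowI2[where m = "- p (\<lambda>i. - x i)"])
      fix t :: real assume "t \<in> {0..}"
      then show "- p (\<lambda>i. - x i) \<le> p (\<lambda>i. x i + t * a i) - t * p a"
        using sublinear_on_lower[OF V p x ta[of t]] sublinear_on_scale[OF V p a, of t] by simp
    qed
  qed (use t in simp)
  have ge: "u \<le> p' x" if "\<And>t. 0 \<le> t \<Longrightarrow> u \<le> p (\<lambda>i. x i + t * a i) - t * p a" for u x
    unfolding p'_def by (rule cINF_greatest) (use that in auto)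
  show "sublinear_on V p'"
    unfolding sublinear_on_def
  proof (intro conjI ballI allI impI)
    fix x y assume x: "x \<in> V" and y: "y \<in> V"
    have *: "p' (\<lambda>i. x i + y i) \<le>
        (p (\<lambda>i. x i + t * a i) - t * p a) + (p (\<lambda>i. y i + s * a i) - s * p a)"
      if "0 \<le> t" "0 \<le> s" for s t
    proof -
      have "p' (\<lambda>i. x i + y i) \<le> p (\<lambda>i. (x i + y i) + (t + s) * a i) - (t + s) * p a"
        using that by (intro le function_space_add V x y) simp
      also have "(\<lambda>i. (x i + y i) + (t + s) * a i) = (\<lambda>i. (x i + t * a i) + (y i + s * a i))"
        by (auto simp: algebra_simps)
      also have "p \<dots> \<le> p (\<lambda>i. x i + t * a i) + p (\<lambda>i. y i + s * a i)"
        by (intro sublinear_on_add[OF p] function_space_add V x y ta)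
      finally show ?thesis by (simp add: algebra_simps)
    qed
    have "p' (\<lambda>i. x i + y i) - (p (\<lambda>i. y i + s * a i) - s * p a) \<le> p' x" if "0 \<le> s" for s
      by (rule ge) (use *[OF _ that] in \<open>simp add: algebra_simps\<close>)
    then have "p' (\<lambda>i. x i + y i) - p' x \<le> p' y"
      by (intro ge) (simp add: algebra_simps)
    then show "p' (\<lambda>i. x i + y i) \<le> p' x + p' y" by simp
  next
    fix x and c :: real assume x: "x \<in> V" and c: "0 < c"
    have "p' (\<lambda>i. c * x i) / c \<le> p' x"
    proof (rule ge)
      fix t :: real assume t: "0 \<le> t"
      have "p' (\<lambda>i. c * x i) \<le> p (\<lambda>i. c * x i + (c * t) * a i) - (c * t) * p a"
        using c t by (intro le function_space_scale V x) simp
      also have "(\<lambda>i. c * x i + (c * t) * a i) = (\<lambda>i. c * (x i + t * a i))"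
        by (auto simp: algebra_simps)
      also have "p \<dots> = c * p (\<lambda>i. x i + t * a i)"
        using c by (intro sublinear_on_scale[OF V p] function_space_add V x ta) simp
      finally show "p' (\<lambda>i. c * x i) / c \<le> p (\<lambda>i. x i + t * a i) - t * p a"
        using c by (simp add: field_simps)
    qed
    then show "p' (\<lambda>i. c * x i) \<le> c * p' x" using c by (simp add: field_simps)
  qed
qed

text \<open>A minimal sublinear functional is linear: replacing \<open>p\<close> by its directional modification
  along \<open>a\<close> cannot decrease it, which gives superadditivity.\<close>

theorem Hahn_Banach_sublinear:
  assumes V: "function_space V" and P: "sublinear_on V P"
  obtains G where "linear_functional_on V G" and "\<And>x. x \<in> V \<Longrightarrow> G x \<le> P x"
proof -
  \<comment> \<open>Setting the functionals to 0 off \<open>V\<close> makes the pointwise order on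
    \<open>S\<close> a comparison on \<open>V\<close>, so that Zorn's lemma can be applied to plain
    functions; \<open>cut\<close> performs this normalisation.\<close>
  define S where "S = {p. sublinear_on V p \<and> (\<forall>x\<in>V. p x \<le> P x) \<and> (\<forall>x. x \<notin> V \<longrightarrow> p x = 0)}"
  define cut where "cut p = (\<lambda>x. if x \<in> V then p x else 0)" for p :: "('a \<Rightarrow> real) \<Rightarrow> real"
  have cutS: "cut p \<in> S" if "sublinear_on V p" "\<And>x. x \<in> V \<Longrightarrow> p x \<le> P x" for p
    using that V by (auto simp: S_def cut_def sublinear_on_def function_space_add function_space_scale)
  have "\<exists>m\<in>S. \<forall>a\<in>S. a \<le> m \<longrightarrow> a = m"
  \<comment> \<open>The order is reversed, so the maximal element obtained is a minimal
    functional.\<close>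
  proof (rule predicate_Zorn[where P = "\<lambda>a b. b \<le> a"])
    show "partial_order_on S (relation_of (\<lambda>a b. b \<le> a) S)"
      by (rule partial_order_on_relation_ofI) auto
    fix C assume C: "C \<in> Chains (relation_of (\<lambda>a b. b \<le> a) S)"
    have CS: "C \<subseteq> S" using C Chains_relation_of by blast
    have chain: "p \<le> q \<or> q \<le> p" if "p \<in> C" "q \<in> C" for p q
      using C that by (auto simp: Chains_def relation_of_def)
    show "\<exists>u\<in>S. \<forall>a\<in>C. u \<le> a"
    \<comment> \<open>An infimum over an empty family has no useful value, so the empty chain gets
      \<open>cut P\<close> as its bound.\<close>
    proof (cases "C = {}")
      case True
      then show ?thesis using cutS[OF P] by blast
    next
      case False
      have bdd: "bdd_below ((\<lambda>p. p x) ` C)" if x: "x \<in> V" for x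
      proof (rule bdd_belowI2[where m = "- P (\<lambda>i. - x i)"])
        fix p assume "p \<in> C"
        then have p: "sublinear_on V p" "\<And>x. x \<in> V \<Longrightarrow> p x \<le> P x" using CS by (auto simp: S_def)
        have "- P (\<lambda>i. - x i) \<le> - p (\<lambda>i. - x i)" using p(2) function_space_minus[OF V x] by simp
        also have "\<dots> \<le> p x" using sublinear_on_lower_minus[OF V p(1) x] .
        finally show "- P (\<lambda>i. - x i) \<le> p x" .
      qed
      define u where "u x = (INF p\<in>C. p x)" for x
      have u: "u x \<le> p x" if "x \<in> V" "p \<in> C" for x p
        unfolding u_def by (rule cINF_lower[OF bdd[OF that(1)] that(2)])
      have "sublinear_on V u"
        unfolding u_def
      proof (rule sublinear_on_Inf_chain[OF V False _ _ bdd])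
        show "sublinear_on V p" if "p \<in> C" for p using that CS by (auto simp: S_def)
        show "(\<forall>x\<in>V. p x \<le> q x) \<or> (\<forall>x\<in>V. q x \<le> p x)" if "p \<in> C" "q \<in> C" for p q
          using chain[OF that] by (auto simp: le_fun_def)
      qed
      moreover have "u x \<le> P x" if "x \<in> V" for x
      proof -
        obtain p where "p \<in> C" using False by blast
        then have "u x \<le> p x" "p x \<le> P x" using u that CS by (auto simp: S_def)
        then show ?thesis by simp
      qed
      ultimately have "cut u \<in> S" by (rule cutS)
      moreover have "cut u \<le> p" if "p \<in> C" for p
        using that CS u by (auto simp: le_fun_def cut_def S_def)
      ultimately show ?thesis by blast
    qed
  qed
  then obtain G where GS: "G \<in> S" and min: "\<And>a. a \<in> S \<Longrightarrow> a \<le> G \<Longrightarrow> a = G" by blast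
  have G: "sublinear_on V G" and GP: "\<And>x. x \<in> V \<Longrightarrow> G x \<le> P x" and G0: "\<And>x. x \<notin> V \<Longrightarrow> G x = 0"
    using GS by (auto simp: S_def)
  have add: "G (\<lambda>i. x i + y i) = G x + G y" if x: "x \<in> V" and y: "y \<in> V" for x y
  proof (rule antisym)
    show "G (\<lambda>i. x i + y i) \<le> G x + G y" using sublinear_on_add[OF G x y] .
    define p' where "p' = (\<lambda>x. INF t\<in>{0..}. G (\<lambda>i. x i + t * y i) - t * G y)"
    have p': "sublinear_on V p'"
      and le: "\<And>x t. x \<in> V \<Longrightarrow> 0 \<le> t \<Longrightarrow> p' x \<le> G (\<lambda>i. x i + t * y i) - t * G y"
      unfolding p'_def using sublinear_on_directional[OF V G y] by blast+
    \<comment> \<open>Step length 0 puts \<open>p'\<close> below \<open>G\<close>; step length 1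
      gives superadditivity once \<open>p'\<close> is known to agree with \<open>G\<close> on
      \<open>V\<close>.\<close>
    have leG: "p' z \<le> G z" if "z \<in> V" for z using le[OF that, of 0] by simp
    have "cut p' = G"
    proof (rule min)
      show "cut p' \<in> S" using p' leG GP by (intro cutS) (auto intro: order_trans)
      show "cut p' \<le> G" using leG G0 by (auto simp: cut_def le_fun_def)
    qed
    then have "cut p' x = G x" by (rule fun_cong)
    then have "G x = p' x" using x by (simp add: cut_def)
    then show "G x + G y \<le> G (\<lambda>i. x i + y i)" using le[OF x, of 1] by simp
  qed
  have minus: "G (\<lambda>i. - x i) = - G x" if x: "x \<in> V" for x
    using add[OF x function_space_minus[OF V x]] sublinear_on_zero[OF V G] by simp
  have "G (\<lambda>i. c * x i) = c * G x" if x: "x \<in> V" for x c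
  proof (cases "0 \<le> c")
    case True
    then show ?thesis using sublinear_on_scale[OF V G x] by simp
  next
    case False
    then have "G (\<lambda>i. (- c) * x i) = (- c) * G x" by (intro sublinear_on_scale[OF V G x]) simp
    then show ?thesis using minus[OF function_space_scale[OF V x, of c]] by simp
  qed
  with add have "linear_functional_on V G" by (auto simp: linear_functional_on_def)
  then show ?thesis using GP that by blast
qed

section \<open>Jordan decomposition\<close>

lemma sigma_algebra_borel_sets_on: "sigma_algebra A (borel_sets_on A)"
  using sets.sigma_algebra_axioms[of "restrict_space borel A"] by (simp add: space_restrict_space)

lemma borel_sets_on_subset: "B \<in> borel_sets_on A \<Longrightarrow> B \<subseteq> A"
  using sets.sets_into_space[of B "restrict_space borel A"] by (simp add: space_restrict_space)

lemma borel_sets_on_top: "A \<in> borel_sets_on A"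
  using sets.top[of "restrict_space borel A"] by (simp add: space_restrict_space)

lemma signed_measure_on_sums:
  "signed_measure_on A f \<Longrightarrow> (\<And>i::nat. F i \<in> borel_sets_on A) \<Longrightarrow> disjoint_family F \<Longrightarrow>
    (\<lambda>i. f (F i)) sums f (\<Union>i. F i)"
  unfolding signed_measure_on_def by blast

lemma signed_measure_on_empty: "signed_measure_on A f \<Longrightarrow> f {} = 0"
  by (simp add: signed_measure_on_def)

text \<open>Countable additivity for the sequence \<open>B\<close>, \<open>C\<close>,
  \<open>{}\<close>, \<open>{}\<close>, and so on, whose remaining terms contribute
  \<open>f {} = 0\<close>.\<close>

lemma signed_measure_on_Un:
  assumes f: "signed_measure_on A f" and B: "B \<in> borel_sets_on A" and C: "C \<in> borel_sets_on A"
    and "B \<inter> C = {}"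
  shows "f (B \<union> C) = f B + f C"
proof -
  let ?F = "binaryset B C"
  have "(\<lambda>i. f (?F i)) sums f (\<Union>i. ?F i)"
    using assms by (intro signed_measure_on_sums[OF f])
      (auto simp: binaryset_def disjoint_family_on_def)
  moreover have "(\<lambda>i. f (?F i)) sums (f B + f C)"
    using f by (intro binaryset_sums) (simp add: signed_measure_on_def)
  ultimately show ?thesis by (metis UN_binaryset_eq sums_unique2)
qed

lemma signed_measure_on_Diff:
  assumes "signed_measure_on A f" "B \<in> borel_sets_on A" "C \<in> borel_sets_on A" "C \<subseteq> B"
  shows "f (B - C) = f B - f C"
  using signed_measure_on_Un[OF assms(1) sets.Diff[OF assms(2,3)] assms(3)] assms(4)
  by (simp add: Un_absorb2 Diff_Int_distrib2)

lemma signed_measure_on_minus: "signed_measure_on A f \<Longrightarrow> signed_measure_on A (\<lambda>B. - f B)"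
  unfolding signed_measure_on_def by (auto intro: sums_minus)

lemma signed_measure_on_diff:
  "signed_measure_on A f \<Longrightarrow> signed_measure_on A g \<Longrightarrow> signed_measure_on A (\<lambda>B. f B - g B)"
  unfolding signed_measure_on_def by (auto intro: sums_diff)

text \<open>If \<open>f\<close> were unbounded, one could split off, again and again, a piece of mass
  larger than 1 in absolute value while staying unbounded on the rest; the disjoint pieces
  contradict convergence.\<close>

lemma signed_measure_on_bounded:
  assumes f: "signed_measure_on A f"
  shows "\<exists>K. \<forall>B\<in>borel_sets_on A. \<bar>f B\<bar> \<le> K"
proof (rule ccontr)
  define U where "U E \<longleftrightarrow> E \<in> borel_sets_on A \<and>
    (\<forall>K. \<exists>B\<in>borel_sets_on A. B \<subseteq> E \<and> K < \<bar>f B\<bar>)" for E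
  assume "\<not> (\<exists>K. \<forall>B\<in>borel_sets_on A. \<bar>f B\<bar> \<le> K)"
  then have UA: "U A"
    unfolding U_def using borel_sets_on_top borel_sets_on_subset by (meson not_le)
  have step: "\<exists>E'. U E' \<and> E' \<subseteq> E \<and> 1 < \<bar>f (E - E')\<bar>" if E: "U E" for E
  proof -
    have ES: "E \<in> borel_sets_on A" using E by (simp add: U_def)
    \<comment> \<open>The excess \<open>1 + \<bar>f E\<bar>\<close> forces both
      \<open>\<bar>f C\<bar>\<close> and \<open>\<bar>f E - f C\<bar>\<close> above 1. Whichever of
      \<open>C\<close> and \<open>E - C\<close> stays unbounded is kept, and the other is a piece of
      mass larger than 1.\<close>
    obtain C where C: "C \<in> borel_sets_on A" "C \<subseteq> E" "1 + \<bar>f E\<bar> < \<bar>f C\<bar>"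
      using E unfolding U_def by blast
    have D: "E - C \<in> borel_sets_on A" using ES C by (intro sets.Diff)
    have fD: "f (E - C) = f E - f C" using signed_measure_on_Diff[OF f ES C(1,2)] .
    have "U C \<or> U (E - C)"
    proof (rule ccontr)
      assume "\<not> (U C \<or> U (E - C))"
      \<comment> \<open>If both halves were bounded, cutting any \<open>B \<subseteq> E\<close>
        along \<open>C\<close> would bound \<open>f\<close> on \<open>E\<close> by
        \<open>K1 + K2\<close>.\<close>
      then obtain K1 K2 where
        K1: "\<And>B. B \<in> borel_sets_on A \<Longrightarrow> B \<subseteq> C \<Longrightarrow> \<bar>f B\<bar> \<le> K1" and
        K2: "\<And>B. B \<in> borel_sets_on A \<Longrightarrow> B \<subseteq> E - C \<Longrightarrow> \<bar>f B\<bar> \<le> K2"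
        unfolding U_def using C D by (meson not_le)
      obtain B where B: "B \<in> borel_sets_on A" "B \<subseteq> E" "K1 + K2 < \<bar>f B\<bar>"
        using E unfolding U_def by blast
      have "f ((B \<inter> C) \<union> (B - C)) = f (B \<inter> C) + f (B - C)"
        using B C by (intro signed_measure_on_Un[OF f] sets.Int sets.Diff) auto
      moreover have "(B \<inter> C) \<union> (B - C) = B" by blast
      moreover have "\<bar>f (B \<inter> C)\<bar> \<le> K1" using B C by (intro K1 sets.Int) auto
      moreover have "\<bar>f (B - C)\<bar> \<le> K2" using B C by (intro K2 sets.Diff) auto
      ultimately show False using B(3) by simp
    qed
    then show ?thesis
    proof
      assume "U C"
      then show ?thesis using C fD by (intro exI[of _ C]) auto
    next
      assume "U (E - C)"
      moreover have "E - (E - C) = C" using C by blast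
      ultimately show ?thesis using C by (intro exI[of _ "E - C"]) auto
    qed
  qed
  obtain E where E0: "E 0 = A" and E: "\<And>n. U (E n)"
    and ES: "\<And>n. E (Suc n) \<subseteq> E n \<and> 1 < \<bar>f (E n - E (Suc n))\<bar>"
    using dependent_nat_choice[of "\<lambda>n E. U E \<and> (n = 0 \<longrightarrow> E = A)"
        "\<lambda>_ E E'. E' \<subseteq> E \<and> 1 < \<bar>f (E - E')\<bar>"] UA step
    by (metis nat.distinct(1))
  have dec: "decseq E" using ES by (simp add: decseq_Suc_iff)
  have "(E i - E (Suc i)) \<inter> (E j - E (Suc j)) = {}" if "i < j" for i j
    using decseqD[OF dec Suc_leI[OF that]] by blast
  then have "disjoint_family (\<lambda>n. E n - E (Suc n))"
    unfolding disjoint_family_on_def by (metis Int_commute linorder_neqE_nat)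
  moreover have "E n - E (Suc n) \<in> borel_sets_on A" for n
    using E unfolding U_def by (intro sets.Diff) auto
  ultimately have "(\<lambda>n. f (E n - E (Suc n))) sums f (\<Union>n. E n - E (Suc n))"
    by (intro signed_measure_on_sums[OF f])
  then have "(\<lambda>n. f (E n - E (Suc n))) \<longlonglongrightarrow> 0" by (intro summable_LIMSEQ_zero sums_summable)
  then obtain n where "\<bar>f (E n - E (Suc n))\<bar> < 1"
    by (auto dest!: LIMSEQ_D[of _ 0 1])
  then show False using ES[of n] by simp
qed

section \<open>The positive and negative parts of a signed measure\<close>

lemma positive_measure_onD:
  assumes "positive_measure_on A f"
  shows "signed_measure_on A f" "\<And>B. B \<in> borel_sets_on A \<Longrightarrow> 0 \<le> f B"
  using assms by (auto simp: positive_measure_on_def)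

text \<open>The boundedness of \<open>f\<close> makes the real-valued supremum in
  \<open>pos_part_on\<close> a genuine upper bound.\<close>

lemma pos_part_on_ge:
  assumes f: "signed_measure_on A f" and C: "C \<in> borel_sets_on A" "C \<subseteq> B"
  shows "f C \<le> pos_part_on A f B"
  unfolding pos_part_on_def
proof (rule cSUP_upper)
  obtain K where "\<forall>B\<in>borel_sets_on A. \<bar>f B\<bar> \<le> K" using signed_measure_on_bounded[OF f] by blast
  then show "bdd_above (f ` {C \<in> borel_sets_on A. C \<subseteq> B})"
    by (intro bdd_aboveI2[where M = K]) (auto dest!: bspec)
qed (use C in auto)

lemma pos_part_on_le:
  assumes "\<And>C. C \<in> borel_sets_on A \<Longrightarrow> C \<subseteq> B \<Longrightarrow> f C \<le> u"
  shows "pos_part_on A f B \<le> u"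
  unfolding pos_part_on_def by (rule cSUP_least) (use assms in auto)

lemma pos_part_on_nonneg:
  "signed_measure_on A f \<Longrightarrow> 0 \<le> pos_part_on A f B"
  using pos_part_on_ge[of A f "{}" B] by (simp add: signed_measure_on_empty)

text \<open>The union of a Borel subset of \<open>B\<close> and one of \<open>C\<close> competes in
  the supremum for \<open>B \<union> C\<close>; the two suprema on the left are then taken one after
  the other.\<close>

lemma pos_part_on_superadditive:
  assumes f: "signed_measure_on A f" and "B \<inter> C = {}"
  shows "pos_part_on A f B + pos_part_on A f C \<le> pos_part_on A f (B \<union> C)"
proof -
  have *: "f B' + f C' \<le> pos_part_on A f (B \<union> C)"
    if "B' \<in> borel_sets_on A" "B' \<subseteq> B" "C' \<in> borel_sets_on A" "C' \<subseteq> C" for B' C'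
  proof -
    have "f B' + f C' = f (B' \<union> C')"
      using that assms(2) by (intro signed_measure_on_Un[OF f, symmetric]) auto
    also have "\<dots> \<le> pos_part_on A f (B \<union> C)"
      using that by (intro pos_part_on_ge[OF f] sets.Un) auto
    finally show ?thesis .
  qed
  have "pos_part_on A f B \<le> pos_part_on A f (B \<union> C) - f C'"
    if "C' \<in> borel_sets_on A" "C' \<subseteq> C" for C'
    by (rule pos_part_on_le) (use *[OF _ _ that] in \<open>simp add: algebra_simps\<close>)
  then have "pos_part_on A f C \<le> pos_part_on A f (B \<union> C) - pos_part_on A f B"
    by (intro pos_part_on_le) (simp add: algebra_simps)
  then show ?thesis by simp
qed

lemma pos_part_on_mono:
  assumes f: "signed_measure_on A f" and "B \<subseteq> C"
  shows "pos_part_on A f B \<le> pos_part_on A f C"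
  using assms by (intro pos_part_on_le pos_part_on_ge) auto

text \<open>Superadditivity and monotonicity bound all partial sums by the value on the union,
  giving summability and one inequality. For the other, a competitor \<open>C\<close> inside the
  union is cut into the pieces \<open>C \<inter> F i\<close>, over which \<open>f\<close> is
  countably additive.\<close>

lemma positive_measure_on_pos_part:
  assumes f: "signed_measure_on A f"
  shows "positive_measure_on A (pos_part_on A f)"
proof -
  let ?p = "pos_part_on A f"
  have p0: "?p {} = 0"
    using f by (intro antisym pos_part_on_le pos_part_on_nonneg) (auto simp: signed_measure_on_empty)
  have "(\<lambda>i. ?p (F i)) sums ?p (\<Union>i. F i)"
    if F: "range F \<subseteq> borel_sets_on A" and disj: "disjoint_family F" for F :: "nat \<Rightarrow> 'a set"
  proof -
    have fin: "(\<Sum>i<n. ?p (F i)) \<le> ?p (\<Union>i<n. F i)" for n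
    proof (induction n)
      case (Suc n)
      have "(\<Sum>i<Suc n. ?p (F i)) \<le> ?p (\<Union>i<n. F i) + ?p (F n)" using Suc by simp
      also have "\<dots> \<le> ?p ((\<Union>i<n. F i) \<union> F n)"
      proof (rule pos_part_on_superadditive[OF f])
        have "F i \<inter> F n = {}" if "i < n" for i
          using disjoint_family_onD[OF disj, of i n] that by simp
        then show "(\<Union>i<n. F i) \<inter> F n = {}" by auto
      qed
      finally show ?case by (simp add: lessThan_Suc Un_commute)
    qed (simp add: p0)
    have le: "(\<Sum>i<n. ?p (F i)) \<le> ?p (\<Union>i. F i)" for n
      by (rule order_trans[OF fin pos_part_on_mono[OF f]]) auto
    have summable: "summable (\<lambda>i. ?p (F i))"
      by (rule summableI_nonneg_bounded[OF pos_part_on_nonneg[OF f] le])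
    have "(\<Sum>i. ?p (F i)) = ?p (\<Union>i. F i)"
    proof (rule antisym)
      show "(\<Sum>i. ?p (F i)) \<le> ?p (\<Union>i. F i)" by (rule suminf_le_const[OF summable le])
      show "?p (\<Union>i. F i) \<le> (\<Sum>i. ?p (F i))"
      proof (rule pos_part_on_le)
        fix C assume C: "C \<in> borel_sets_on A" "C \<subseteq> (\<Union>i. F i)"
        have "(C \<inter> F m) \<inter> (C \<inter> F n) = {}" if "m \<noteq> n" for m n
          using disjoint_family_onD[OF disj, of m n] that by auto
        then have "(\<lambda>i. f (C \<inter> F i)) sums f (\<Union>i. C \<inter> F i)"
          using F C
          by (intro signed_measure_on_sums[OF f] sets.Int) (auto simp: disjoint_family_on_def)
        moreover have "(\<Union>i. C \<inter> F i) = C" using C by blast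
        ultimately have s: "(\<lambda>i. f (C \<inter> F i)) sums f C" by simp
        then have "f C = (\<Sum>i. f (C \<inter> F i))" by (rule sums_unique)
        also have "\<dots> \<le> (\<Sum>i. ?p (F i))"
          using F C s summable by (intro suminf_le pos_part_on_ge[OF f] sets.Int) (auto simp: sums_iff)
        finally show "f C \<le> (\<Sum>i. ?p (F i))" .
      qed
    qed
    then show ?thesis using summable by (simp add: sums_iff)
  qed
  then show ?thesis
    using p0 pos_part_on_nonneg[OF f] by (auto simp: positive_measure_on_def signed_measure_on_def)
qed

lemma neg_part_on_eq: "neg_part_on A f = pos_part_on A (\<lambda>B. - f B)"
  by (rule ext) (simp add: neg_part_on_def pos_part_on_def)

lemma positive_measure_on_neg_part:
  "signed_measure_on A f \<Longrightarrow> positive_measure_on A (neg_part_on A f)"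
  unfolding neg_part_on_eq by (intro positive_measure_on_pos_part signed_measure_on_minus)

text \<open>For \<open>C \<subseteq> B\<close>, \<open>h C\<close> equals \<open>h B\<close> plus
  \<open>- h (B - C)\<close>, and the latter competes in the supremum for \<open>- h\<close>. Taking
  \<open>h\<close> to be \<open>f\<close> and then \<open>- f\<close> gives the two
  inequalities.\<close>

lemma Jordan_decomposition_on:
  assumes f: "signed_measure_on A f" and B: "B \<in> borel_sets_on A"
  shows "f B = pos_part_on A f B - neg_part_on A f B"
proof -
  have sub: "pos_part_on A h B \<le> h B + pos_part_on A (\<lambda>B. - h B) B" if h: "signed_measure_on A h" for h
  proof (rule pos_part_on_le)
    fix C assume C: "C \<in> borel_sets_on A" "C \<subseteq> B"
    have "- h (B - C) \<le> pos_part_on A (\<lambda>B. - h B) B"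
      using B C by (intro pos_part_on_ge[OF signed_measure_on_minus[OF h]]) auto
    then show "h C \<le> h B + pos_part_on A (\<lambda>B. - h B) B"
      using signed_measure_on_Diff[OF h B C] by simp
  qed
  show ?thesis
    unfolding neg_part_on_eq using sub[OF f] sub[OF signed_measure_on_minus[OF f]] by simp
qed

section \<open>Integrals of bounded measurable functions\<close>

text \<open>The space for the Hahn-Banach theorem. It contains the indicators of Borel sets, so a
  functional on it yields a set function by mere evaluation, and for compact \<open>A\<close> it
  contains the Lipschitz functions.\<close>

definition bounded_measurable_on :: "'a::topological_space set \<Rightarrow> ('a \<Rightarrow> real) set" where
  "bounded_measurable_on A =
     {\<phi> \<in> borel_measurable (restrict_space borel A). \<exists>K. \<forall>x\<in>A. \<bar>\<phi> x\<bar> \<le> K}"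

text \<open>Boundedness for the sup norm on \<open>A\<close>, phrased through arbitrary bounds
  \<open>s\<close> so that no supremum has to be formed.\<close>

definition sup_continuous_on ::
    "'a::topological_space set \<Rightarrow> (('a \<Rightarrow> real) \<Rightarrow> real) \<Rightarrow> bool" where
  "sup_continuous_on A I \<longleftrightarrow>
     (\<exists>K. \<forall>\<phi>\<in>bounded_measurable_on A. \<forall>s. (\<forall>x\<in>A. \<bar>\<phi> x\<bar> \<le> s) \<longrightarrow> \<bar>I \<phi>\<bar> \<le> K * s)"

lemma sup_continuous_onI:
  "(\<And>\<phi> s. \<phi> \<in> bounded_measurable_on A \<Longrightarrow> (\<And>x. x \<in> A \<Longrightarrow> \<bar>\<phi> x\<bar> \<le> s) \<Longrightarrow> \<bar>I \<phi>\<bar> \<le> K * s) \<Longrightarrow>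
    sup_continuous_on A I"
  unfolding sup_continuous_on_def by blast

lemma sup_continuous_on_diff:
  assumes "sup_continuous_on A I" "sup_continuous_on A J"
  shows "sup_continuous_on A (\<lambda>\<phi>. I \<phi> - J \<phi>)"
proof -
  obtain K L where
    K: "\<And>\<phi> s. \<phi> \<in> bounded_measurable_on A \<Longrightarrow> (\<forall>x\<in>A. \<bar>\<phi> x\<bar> \<le> s) \<Longrightarrow> \<bar>I \<phi>\<bar> \<le> K * s" and
    L: "\<And>\<phi> s. \<phi> \<in> bounded_measurable_on A \<Longrightarrow> (\<forall>x\<in>A. \<bar>\<phi> x\<bar> \<le> s) \<Longrightarrow> \<bar>J \<phi>\<bar> \<le> L * s"
    using assms unfolding sup_continuous_on_def by blast
  show ?thesis
  proof (rule sup_continuous_onI[where K = "K + L"])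
    fix \<phi> s assume "\<phi> \<in> bounded_measurable_on A" "\<And>x. x \<in> A \<Longrightarrow> \<bar>\<phi> x\<bar> \<le> s"
    then have "\<bar>I \<phi>\<bar> \<le> K * s" "\<bar>J \<phi>\<bar> \<le> L * s" using K L by blast+
    then show "\<bar>I \<phi> - J \<phi>\<bar> \<le> (K + L) * s" by (simp add: algebra_simps)
  qed
qed

lemma function_space_bounded_measurable_on: "function_space (bounded_measurable_on A)"
proof -
  have "\<exists>K. \<forall>x\<in>A. \<bar>\<phi> x + \<psi> x\<bar> \<le> K"
    if "\<forall>x\<in>A. \<bar>\<phi> x\<bar> \<le> K" "\<forall>x\<in>A. \<bar>\<psi> x\<bar> \<le> L" for \<phi> \<psi> :: "'a \<Rightarrow> real" and K L
    using that by (intro exI[of _ "K + L"]) (force dest!: bspec)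
  moreover have "\<exists>K. \<forall>x\<in>A. \<bar>c * \<phi> x\<bar> \<le> K" if "\<forall>x\<in>A. \<bar>\<phi> x\<bar> \<le> K"
    for \<phi> :: "'a \<Rightarrow> real" and K c
    using that by (intro exI[of _ "\<bar>c\<bar> * K"]) (auto simp: abs_mult intro: mult_left_mono)
  ultimately show ?thesis
    unfolding function_space_def bounded_measurable_on_def by auto
qed

lemma indicator_bounded_measurable_on:
  "B \<in> borel_sets_on A \<Longrightarrow> indicator B \<in> bounded_measurable_on A"
  unfolding bounded_measurable_on_def by (auto intro!: exI[of _ 1] simp: indicator_def)

text \<open>Rounding \<open>\<phi>\<close> down to multiples of \<open>e\<close> gives a finite
  combination of indicators within \<open>e\<close> of \<open>\<phi>\<close> on \<open>A\<close>.
  Hence indicators determine a sup-continuous linear functional, which later identifies an integral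
  with a functional known on sets.\<close>

lemma linear_functional_on_eq_zero:
  assumes J: "linear_functional_on (bounded_measurable_on A) J" and cont: "sup_continuous_on A J"
    and ind: "\<And>B. B \<in> borel_sets_on A \<Longrightarrow> J (indicator B) = 0"
    and \<phi>: "\<phi> \<in> bounded_measurable_on A"
  shows "J \<phi> = 0"
proof (rule ccontr)
  assume nz: "J \<phi> \<noteq> 0"
  let ?V = "bounded_measurable_on A"
  have V: "function_space ?V" by (rule function_space_bounded_measurable_on)
  obtain L where L: "\<And>\<psi> s. \<psi> \<in> ?V \<Longrightarrow> (\<forall>x\<in>A. \<bar>\<psi> x\<bar> \<le> s) \<Longrightarrow> \<bar>J \<psi>\<bar> \<le> L * s"
    using cont unfolding sup_continuous_on_def by blast
  obtain K where K: "\<And>x. x \<in> A \<Longrightarrow> \<bar>\<phi> x\<bar> \<le> K" and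
    meas[measurable]: "\<phi> \<in> borel_measurable (restrict_space borel A)"
    using \<phi> unfolding bounded_measurable_on_def by blast
  \<comment> \<open>Chosen so that the error \<open>L * e\<close> is strictly less than
    \<open>(\<bar>L\<bar> + 1) * e = \<bar>J \<phi>\<bar>\<close>, the contradiction reached at the
    end.\<close>
  define e where "e = \<bar>J \<phi>\<bar> / (\<bar>L\<bar> + 1)"
  have e: "0 < e" using nz by (simp add: e_def)
  define B where "B k = {x \<in> A. \<lfloor>\<phi> x / e\<rfloor> = k}" for k
  have B: "B k \<in> borel_sets_on A" for k
  proof -
    have "{x \<in> space (restrict_space borel A). \<lfloor>\<phi> x / e\<rfloor> = k} \<in> borel_sets_on A" by measurable
    then show ?thesis by (simp add: B_def space_restrict_space)
  qed
  \<comment> \<open>A finite range containing every value of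
    \<open>\<lfloor>\<phi> x / e\<rfloor>\<close> allowed by
    \<open>\<bar>\<phi> x\<bar> \<le> K\<close>.\<close>
  define S where "S = {-\<lceil>K / e\<rceil> - 1..\<lceil>K / e\<rceil>}"
  define \<psi> where "\<psi> x = (\<Sum>k\<in>S. (of_int k * e) * indicator (B k) x)" for x
  have "\<psi> \<in> ?V \<and> J \<psi> = (\<Sum>k\<in>S. (of_int k * e) * J (indicator (B k)))"
    unfolding \<psi>_def
    by (rule linear_functional_on_sum[OF V J])
      (auto simp: S_def intro: indicator_bounded_measurable_on B)
  then have \<psi>: "\<psi> \<in> ?V" and J\<psi>: "J \<psi> = 0" using ind[OF B] by auto
  have "\<bar>\<phi> x - \<psi> x\<bar> \<le> e" if x: "x \<in> A" for x
  proof -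
    let ?k = "\<lfloor>\<phi> x / e\<rfloor>"
    have "- (K / e) \<le> \<phi> x / e" "\<phi> x / e \<le> K / e"
      using K[OF x] e by (auto simp: field_simps abs_le_iff)
    then have "?k \<in> S" unfolding S_def by simp linarith
    have "\<psi> x = (\<Sum>k\<in>S. if k = ?k then of_int k * e else 0)"
      unfolding \<psi>_def using x by (intro sum.cong) (auto simp: B_def indicator_def)
    also have "\<dots> = of_int ?k * e" using \<open>?k \<in> S\<close> by (simp add: S_def)
    finally have "\<psi> x = of_int ?k * e" .
    moreover have "of_int ?k * e \<le> \<phi> x"
      using of_int_floor_le[of "\<phi> x / e"] unfolding pos_le_divide_eq[OF e] .
    moreover have "\<phi> x < (of_int ?k + 1) * e"
      using floor_correct[of "\<phi> x / e"] unfolding pos_divide_less_eq[OF e] by simp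
    ultimately show ?thesis by (simp add: algebra_simps)
  qed
  then have "\<bar>J (\<lambda>x. \<phi> x - \<psi> x)\<bar> \<le> L * e"
    by (intro L function_space_diff[OF V \<phi> \<psi>]) blast
  then have "\<bar>J \<phi>\<bar> \<le> L * e"
    using linear_functional_on_sub[OF V J \<phi> \<psi>] J\<psi> by simp
  also have "L * e < (\<bar>L\<bar> + 1) * e" using e by (intro mult_strict_right_mono) auto
  also have "\<dots> = \<bar>J \<phi>\<bar>" by (simp add: e_def)
  finally show False by simp
qed

section \<open>Positive set functions as measures, and their integrals\<close>

lemma space_to_measure_on: "space (to_measure_on A f) = A"
  and sets_to_measure_on: "sets (to_measure_on A f) = borel_sets_on A"
proof -
  interpret sigma_algebra A "borel_sets_on A" by (rule sigma_algebra_borel_sets_on)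
  show "space (to_measure_on A f) = A" "sets (to_measure_on A f) = borel_sets_on A"
    by (simp_all add: to_measure_on_def space_measure_of[OF space_closed] sets_measure_of_eq)
qed

text \<open>Positivity and countable additivity keep \<open>ennreal\<close> from truncating and
  \<open>measure_of\<close> from returning its default, the zero measure.\<close>

lemma emeasure_to_measure_on:
  assumes f: "positive_measure_on A f" and B: "B \<in> borel_sets_on A"
  shows "emeasure (to_measure_on A f) B = ennreal (f B)"
  unfolding to_measure_on_def
proof (rule emeasure_measure_of_sigma[OF sigma_algebra_borel_sets_on _ _ B])
  note fs = positive_measure_onD(1)[OF f] and f0 = positive_measure_onD(2)[OF f]
  show "positive (borel_sets_on A) (\<lambda>B. ennreal (f B))"
    using fs by (simp add: positive_def signed_measure_on_empty)
  show "countably_additive (borel_sets_on A) (\<lambda>B. ennreal (f B))"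
    unfolding countably_additive_def
  proof (intro allI impI)
    fix F :: "nat \<Rightarrow> 'a set"
    assume F: "range F \<subseteq> borel_sets_on A" "disjoint_family F" "(\<Union>i. F i) \<in> borel_sets_on A"
    then have "(\<lambda>i. ennreal (f (F i))) sums ennreal (f (\<Union>i. F i))"
      using signed_measure_on_sums[OF fs, of F] f0 by (subst sums_ennreal) auto
    then show "(\<Sum>i. ennreal (f (F i))) = ennreal (f (\<Union>i. F i))" by (simp add: sums_iff)
  qed
qed

lemma finite_measure_to_measure_on:
  "positive_measure_on A f \<Longrightarrow> finite_measure (to_measure_on A f)"
  by (rule finite_measureI)
    (simp add: space_to_measure_on emeasure_to_measure_on borel_sets_on_top)

lemma measure_to_measure_on:
  "positive_measure_on A f \<Longrightarrow> B \<in> borel_sets_on A \<Longrightarrow> measure (to_measure_on A f) B = f B"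
  by (simp add: measure_def emeasure_to_measure_on positive_measure_onD)

lemma borel_measurable_to_measure_on:
  "\<phi> \<in> bounded_measurable_on A \<Longrightarrow> \<phi> \<in> borel_measurable (to_measure_on A f)"
  by (simp add: bounded_measurable_on_def sets_to_measure_on cong: measurable_cong_sets)

lemma integrable_to_measure_on:
  assumes f: "positive_measure_on A f" and \<phi>: "\<phi> \<in> bounded_measurable_on A"
  shows "integrable (to_measure_on A f) \<phi>"
proof -
  interpret finite_measure "to_measure_on A f" using f by (rule finite_measure_to_measure_on)
  obtain K where "\<And>x. x \<in> A \<Longrightarrow> \<bar>\<phi> x\<bar> \<le> K"
    using \<phi> unfolding bounded_measurable_on_def by blast
  then show ?thesis
    using borel_measurable_to_measure_on[OF \<phi>]
    by (intro integrable_const_bound[where B = K] AE_I2) (auto simp: space_to_measure_on)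
qed

lemma linear_functional_on_integral:
  assumes f: "positive_measure_on A f"
  shows "linear_functional_on (bounded_measurable_on A) (\<lambda>\<phi>. LINT x|to_measure_on A f. \<phi> x)"
  unfolding linear_functional_on_def using integrable_to_measure_on[OF f] by auto

lemma integral_to_measure_on_le:
  assumes f: "positive_measure_on A f" and \<phi>: "\<phi> \<in> bounded_measurable_on A"
    and le: "\<And>x. x \<in> A \<Longrightarrow> \<phi> x \<le> s"
  shows "(LINT x|to_measure_on A f. \<phi> x) \<le> f A * s"
proof -
  interpret finite_measure "to_measure_on A f" using f by (rule finite_measure_to_measure_on)
  have "(LINT x|to_measure_on A f. \<phi> x) \<le> (LINT x|to_measure_on A f. s)"
    using le integrable_to_measure_on[OF f \<phi>]
    by (intro integral_mono) (auto simp: space_to_measure_on)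
  then show ?thesis
    using measure_to_measure_on[OF f borel_sets_on_top] by (simp add: space_to_measure_on)
qed

lemma sup_continuous_on_integral:
  assumes f: "positive_measure_on A f"
  shows "sup_continuous_on A (\<lambda>\<phi>. LINT x|to_measure_on A f. \<phi> x)"
proof (rule sup_continuous_onI[where K = "f A"])
  fix \<phi> s assume \<phi>: "\<phi> \<in> bounded_measurable_on A" and s: "\<And>x. x \<in> A \<Longrightarrow> \<bar>\<phi> x\<bar> \<le> s"
  have m\<phi>: "(\<lambda>x. - \<phi> x) \<in> bounded_measurable_on A"
    by (rule function_space_minus[OF function_space_bounded_measurable_on \<phi>])
  have "(LINT x|to_measure_on A f. \<phi> x) \<le> f A * s"
    using s by (intro integral_to_measure_on_le[OF f \<phi>]) (auto simp: abs_le_iff)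
  moreover have "(LINT x|to_measure_on A f. - \<phi> x) \<le> f A * s"
    using s by (intro integral_to_measure_on_le[OF f m\<phi>]) (auto simp: abs_le_iff)
  ultimately show "\<bar>LINT x|to_measure_on A f. \<phi> x\<bar> \<le> f A * s" by simp
qed

lemma integral_indicator_to_measure_on:
  assumes f: "positive_measure_on A f" and B: "B \<in> borel_sets_on A"
  shows "(LINT x|to_measure_on A f. indicator B x) = f B"
  using borel_sets_on_subset[OF B] measure_to_measure_on[OF f B]
  by (simp add: space_to_measure_on Int_absorb2)

section \<open>Integration against a signed measure\<close>

lemma linear_functional_on_signed_integral:
  assumes "signed_measure_on A f"
  shows "linear_functional_on (bounded_measurable_on A) (signed_integral_on A f)"
  using linear_functional_on_diff[OF
      linear_functional_on_integral[OF positive_measure_on_pos_part[OF assms]]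
      linear_functional_on_integral[OF positive_measure_on_neg_part[OF assms]]]
  by (simp add: signed_integral_on_def[abs_def])

lemma sup_continuous_on_signed_integral:
  assumes "signed_measure_on A f"
  shows "sup_continuous_on A (signed_integral_on A f)"
  using sup_continuous_on_diff[OF
      sup_continuous_on_integral[OF positive_measure_on_pos_part[OF assms]]
      sup_continuous_on_integral[OF positive_measure_on_neg_part[OF assms]]]
  by (simp add: signed_integral_on_def[abs_def])

text \<open>Ties the integral, built from the two Jordan parts, back to \<open>f\<close>
  itself.\<close>

lemma signed_integral_on_indicator:
  assumes f: "signed_measure_on A f" and B: "B \<in> borel_sets_on A"
  shows "signed_integral_on A f (indicator B) = f B"
  unfolding signed_integral_on_def Jordan_decomposition_on[OF f B]
  using integral_indicator_to_measure_on[OF _ B] positive_measure_on_pos_part[OF f]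
    positive_measure_on_neg_part[OF f] by metis

section \<open>Lipschitz functions\<close>

lemma bdd_below_lipschitz_on: "bdd_below {L. L-lipschitz_on A \<xi>}"
  by (rule bdd_belowI[of _ 0]) (auto simp: lipschitz_on_nonneg)

lemma lip_const_le: "L-lipschitz_on A \<xi> \<Longrightarrow> lip_const A \<xi> \<le> L"
  unfolding lip_const_def by (rule cInf_lower[OF _ bdd_below_lipschitz_on]) simp

text \<open>The infimum is attained: each difference quotient lies below every admissible constant,
  hence below their infimum.\<close>

lemma lipschitz_on_lip_const:
  assumes "L-lipschitz_on A \<xi>"
  shows "(lip_const A \<xi>)-lipschitz_on A \<xi>"
proof (rule lipschitz_onI)
  have ge: "u \<le> lip_const A \<xi>" if "\<And>M. M-lipschitz_on A \<xi> \<Longrightarrow> u \<le> M" for u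
    unfolding lip_const_def by (rule cInf_greatest) (use assms that in auto)
  show "0 \<le> lip_const A \<xi>" by (rule ge) (rule lipschitz_on_nonneg)
  fix x y assume xy: "x \<in> A" "y \<in> A"
  show "dist (\<xi> x) (\<xi> y) \<le> lip_const A \<xi> * dist x y"
  proof (cases "x = y")
    case False
    have "dist (\<xi> x) (\<xi> y) / dist x y \<le> lip_const A \<xi>"
    proof (rule ge)
      fix M assume "M-lipschitz_on A \<xi>"
      then show "dist (\<xi> x) (\<xi> y) / dist x y \<le> M"
        using lipschitz_onD[OF _ xy] False by (simp add: divide_le_eq)
    qed
    then show ?thesis using False by (simp add: divide_le_eq)
  qed simp
qed

lemma Lip_vanishing_lipschitz_on:
  "\<xi> \<in> Lip_vanishing \<Omega> A \<Longrightarrow> (lip_const A \<xi>)-lipschitz_on A \<xi>"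
  unfolding Lip_vanishing_def using lipschitz_on_lip_const by blast

lemma Lip_vanishingI:
  "L-lipschitz_on A \<xi> \<Longrightarrow> (\<And>x. x \<in> A - \<Omega> \<Longrightarrow> \<xi> x = 0) \<Longrightarrow> \<xi> \<in> Lip_vanishing \<Omega> A"
  unfolding Lip_vanishing_def by blast

lemma Lip_vanishing_zero: "\<xi> \<in> Lip_vanishing \<Omega> A \<Longrightarrow> x \<in> A - \<Omega> \<Longrightarrow> \<xi> x = 0"
  unfolding Lip_vanishing_def by blast

lemma
  assumes "\<xi> \<in> Lip_vanishing \<Omega> A" "\<eta> \<in> Lip_vanishing \<Omega> A"
  shows Lip_vanishing_add: "(\<lambda>x. \<xi> x + \<eta> x) \<in> Lip_vanishing \<Omega> A"
    and lip_const_add: "lip_const A (\<lambda>x. \<xi> x + \<eta> x) \<le> lip_const A \<xi> + lip_const A \<eta>"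
proof -
  have *: "(lip_const A \<xi> + lip_const A \<eta>)-lipschitz_on A (\<lambda>x. \<xi> x + \<eta> x)"
    by (intro lipschitz_on_add assms[THEN Lip_vanishing_lipschitz_on])
  then show "lip_const A (\<lambda>x. \<xi> x + \<eta> x) \<le> lip_const A \<xi> + lip_const A \<eta>" by (rule lip_const_le)
  show "(\<lambda>x. \<xi> x + \<eta> x) \<in> Lip_vanishing \<Omega> A"
    using assms[THEN Lip_vanishing_zero] by (intro Lip_vanishingI[OF *]) auto
qed

lemma
  assumes "\<xi> \<in> Lip_vanishing \<Omega> A" "0 \<le> c"
  shows Lip_vanishing_scale: "(\<lambda>x. c * \<xi> x) \<in> Lip_vanishing \<Omega> A"
    and lip_const_scale: "lip_const A (\<lambda>x. c * \<xi> x) \<le> c * lip_const A \<xi>"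
proof -
  have *: "(c * lip_const A \<xi>)-lipschitz_on A (\<lambda>x. c * \<xi> x)"
    using Lip_vanishing_lipschitz_on[OF assms(1)] assms(2)
    by (rule lipschitz_on_cmult_real_nonneg)
  then show "lip_const A (\<lambda>x. c * \<xi> x) \<le> c * lip_const A \<xi>" by (rule lip_const_le)
  show "(\<lambda>x. c * \<xi> x) \<in> Lip_vanishing \<Omega> A"
    using Lip_vanishing_zero[OF assms(1)] by (intro Lip_vanishingI[OF *]) auto
qed

text \<open>The map \<open>t \<mapsto> max 0 (- t)\<close> is 1-Lipschitz and fixes 0.\<close>

lemma
  assumes "\<xi> \<in> Lip_vanishing \<Omega> A"
  shows Lip_vanishing_neg_part: "(\<lambda>x. max 0 (- \<xi> x)) \<in> Lip_vanishing \<Omega> A"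
    and lip_const_neg_part: "lip_const A (\<lambda>x. max 0 (- \<xi> x)) \<le> lip_const A \<xi>"
proof -
  note L = Lip_vanishing_lipschitz_on[OF assms]
  have *: "(lip_const A \<xi>)-lipschitz_on A (\<lambda>x. max 0 (- \<xi> x))"
  proof (rule lipschitz_onI[OF _ lipschitz_on_nonneg[OF L]])
    fix x y assume "x \<in> A" "y \<in> A"
    have "dist (max 0 (- \<xi> x)) (max 0 (- \<xi> y)) \<le> dist (\<xi> x) (\<xi> y)"
      by (auto simp: dist_real_def max_def)
    also have "\<dots> \<le> lip_const A \<xi> * dist x y" using L \<open>x \<in> A\<close> \<open>y \<in> A\<close> by (rule lipschitz_onD)
    finally show "dist (max 0 (- \<xi> x)) (max 0 (- \<xi> y)) \<le> lip_const A \<xi> * dist x y" .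
  qed
  then show "lip_const A (\<lambda>x. max 0 (- \<xi> x)) \<le> lip_const A \<xi>" by (rule lip_const_le)
  show "(\<lambda>x. max 0 (- \<xi> x)) \<in> Lip_vanishing \<Omega> A"
    using Lip_vanishing_zero[OF assms] by (intro Lip_vanishingI[OF *]) auto
qed

lemma Lip_vanishing_const_zero: "(\<lambda>_. 0) \<in> Lip_vanishing \<Omega> A"
  and lip_const_const_zero: "lip_const A (\<lambda>_. 0) \<le> 0"
  using lipschitz_on_constant[of A 0] by (auto intro: Lip_vanishingI lip_const_le)

text \<open>Lipschitz continuity gives measurability on \<open>A\<close>, and compactness gives the
  bound.\<close>

lemma Lip_vanishing_bounded_measurable_on:
  assumes "compact A" and \<xi>: "\<xi> \<in> Lip_vanishing \<Omega> A"
  shows "\<xi> \<in> bounded_measurable_on A"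
proof -
  have cont: "continuous_on A \<xi>"
    by (rule lipschitz_on_continuous_on[OF Lip_vanishing_lipschitz_on[OF \<xi>]])
  then have "bounded (\<xi> ` A)"
    using assms(1) by (intro compact_imp_bounded compact_continuous_image)
  then show ?thesis
    using borel_measurable_continuous_on_restrict[OF cont]
    by (auto simp: bounded_measurable_on_def bounded_iff)
qed

section \<open>Extension and representation\<close>

lemma bounded_measurable_on_max_zero:
  assumes "\<phi> \<in> bounded_measurable_on A"
  shows "(\<lambda>x. max 0 (\<phi> x)) \<in> bounded_measurable_on A"
proof -
  obtain K where K: "\<And>x. x \<in> A \<Longrightarrow> \<bar>\<phi> x\<bar> \<le> K"
    using assms unfolding bounded_measurable_on_def by blast
  have "\<bar>max 0 (\<phi> x)\<bar> \<le> K" if "x \<in> A" for x using K[OF that] by linarith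
  then show ?thesis using assms unfolding bounded_measurable_on_def by auto
qed

text \<open>Sublinearity is inherited from the pointwise map
  \<open>t \<mapsto> max 0 t\<close>.\<close>

lemma
  assumes f: "positive_measure_on A f"
  defines "q \<equiv> \<lambda>\<phi>. LINT x|to_measure_on A f. max 0 (\<phi> x)"
  shows sublinear_on_integral_pos_part: "sublinear_on (bounded_measurable_on A) q"
    and integral_pos_part_le:
      "\<And>\<phi> s. \<phi> \<in> bounded_measurable_on A \<Longrightarrow> (\<And>x. x \<in> A \<Longrightarrow> \<bar>\<phi> x\<bar> \<le> s) \<Longrightarrow> q \<phi> \<le> f A * s"
proof -
  note V = function_space_bounded_measurable_on[of A]
  note int = integrable_to_measure_on[OF f bounded_measurable_on_max_zero]
  show "sublinear_on (bounded_measurable_on A) q"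
    unfolding sublinear_on_def
  proof (intro conjI ballI allI impI)
    fix \<phi> \<psi> assume \<phi>: "\<phi> \<in> bounded_measurable_on A" and \<psi>: "\<psi> \<in> bounded_measurable_on A"
    have "q (\<lambda>x. \<phi> x + \<psi> x) \<le> (LINT x|to_measure_on A f. max 0 (\<phi> x) + max 0 (\<psi> x))"
      unfolding q_def using int[OF \<phi>] int[OF \<psi>] int[OF function_space_add[OF V \<phi> \<psi>]]
      by (intro integral_mono) auto
    also have "\<dots> = q \<phi> + q \<psi>" unfolding q_def using int[OF \<phi>] int[OF \<psi>] by simp
    finally show "q (\<lambda>x. \<phi> x + \<psi> x) \<le> q \<phi> + q \<psi>" .
  next
    fix \<phi> :: "'a \<Rightarrow> real" and c :: real assume "0 < c"
    then have "max 0 (c * \<phi> x) = c * max 0 (\<phi> x)" for x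
      by (auto simp: max_def zero_le_mult_iff mult_le_0_iff)
    then show "q (\<lambda>x. c * \<phi> x) \<le> c * q \<phi>" by (simp add: q_def)
  qed
  show "q \<phi> \<le> f A * s"
    if "\<phi> \<in> bounded_measurable_on A" "\<And>x. x \<in> A \<Longrightarrow> \<bar>\<phi> x\<bar> \<le> s" for \<phi> s
    unfolding q_def
  proof (rule integral_to_measure_on_le[OF f bounded_measurable_on_max_zero[OF that(1)]])
    show "max 0 (\<phi> x) \<le> s" if "x \<in> A" for x
      using \<open>\<And>x. x \<in> A \<Longrightarrow> \<bar>\<phi> x\<bar> \<le> s\<close>[OF that] by linarith
  qed
qed

text \<open>Domination tested on an indicator gives \<open>g \<le> \<mu>\<close>; tested on its
  negative, whose positive part is 0, it gives \<open>0 \<le> g\<close>. Finite additivity is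
  linearity, and countable additivity follows because the remainder after \<open>n\<close> sets has
  \<open>g\<close>-mass between 0 and its \<open>\<mu>\<close>-mass, which tends to 0.\<close>

lemma dominated_functional_measure:
  assumes \<mu>: "positive_measure_on A \<mu>"
    and G: "linear_functional_on (bounded_measurable_on A) G"
    and le: "\<And>\<phi>. \<phi> \<in> bounded_measurable_on A \<Longrightarrow> G \<phi> \<le> (LINT x|to_measure_on A \<mu>. max 0 (\<phi> x))"
  defines "g \<equiv> \<lambda>B. G (indicator B)"
  shows "positive_measure_on A g"
    and "measure_le_on A g \<mu>"
    and "sup_continuous_on A G"
proof -
  note V = function_space_bounded_measurable_on[of A]
  note ind = indicator_bounded_measurable_on
  note \<mu>s = positive_measure_onD(1)[OF \<mu>]
  have g_le: "g B \<le> \<mu> B" if B: "B \<in> borel_sets_on A" for B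
  proof -
    have "g B \<le> (LINT x|to_measure_on A \<mu>. max 0 (indicator B x))"
      unfolding g_def by (rule le[OF ind[OF B]])
    also have "(\<lambda>x. max 0 (indicator B x)) = (indicator B :: 'a \<Rightarrow> real)"
      by (auto simp: indicator_def)
    finally show ?thesis using integral_indicator_to_measure_on[OF \<mu> B] by simp
  qed
  have g_nonneg: "0 \<le> g B" if B: "B \<in> borel_sets_on A" for B
  proof -
    have "- g B \<le> (LINT x|to_measure_on A \<mu>. max 0 (- indicator B x))"
      unfolding g_def linear_functional_on_minus[OF G ind[OF B], symmetric]
      by (rule le[OF function_space_minus[OF V ind[OF B]]])
    also have "(\<lambda>x. max 0 (- indicator B x)) = (\<lambda>x::'a. 0::real)"
      by (auto simp: indicator_def)
    finally show ?thesis by simp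
  qed
  have g_Un: "g (B \<union> C) = g B + g C"
    if B: "B \<in> borel_sets_on A" and C: "C \<in> borel_sets_on A" and "B \<inter> C = {}" for B C
  proof -
    have "(indicator (B \<union> C) :: 'a \<Rightarrow> real) = (\<lambda>x. indicator B x + indicator C x)"
      using that(3) by (auto simp: indicator_def fun_eq_iff)
    then show ?thesis
      unfolding g_def using linear_functional_on_add[OF G ind[OF B] ind[OF C]] by simp
  qed
  \<comment> \<open>Additivity on two empty sets reads \<open>g {} = g {} + g {}\<close>.\<close>
  have g0: "g {} = 0"
    using g_Un[of "{}" "{}"] by simp
  have "(\<lambda>i. g (F i)) sums g (\<Union>i. F i)"
    if F: "range F \<subseteq> borel_sets_on A" and disj: "disjoint_family F" for F :: "nat \<Rightarrow> 'a set"
  proof -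
    have FS: "F i \<in> borel_sets_on A" for i using F by blast
    define U where "U = (\<Union>i. F i)"
    define P where "P n = (\<Union>i<n. F i)" for n
    have US: "U \<in> borel_sets_on A" unfolding U_def using F by (intro sets.countable_UN) auto
    have PS: "P n \<in> borel_sets_on A" for n unfolding P_def using FS by (intro sets.finite_UN) auto
    have PF: "P n \<inter> F n = {}" for n
    proof -
      have "F i \<inter> F n = {}" if "i < n" for i
        using disjoint_family_onD[OF disj, of i n] that by simp
      then show ?thesis by (auto simp: P_def)
    qed
    \<comment> \<open>Stated for a general \<open>h\<close> because it serves both
      \<open>\<mu>\<close> and \<open>g\<close>, the latter not yet known to be countably
      additive.\<close>
    have sumP: "(\<Sum>i<n. h (F i)) = h (P n)"
      if "h {} = 0" and "\<And>B C. B \<in> borel_sets_on A \<Longrightarrow> C \<in> borel_sets_on A \<Longrightarrow> B \<inter> C = {} \<Longrightarrow>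
        h (B \<union> C) = h B + h C" for h :: "'a set \<Rightarrow> real" and n
    proof (induction n)
      case (Suc n)
      have "P (Suc n) = P n \<union> F n" by (auto simp: P_def lessThan_Suc)
      then show ?case using Suc that(2)[OF PS FS PF] by simp
    qed (simp add: P_def that(1))
    have diff: "0 \<le> g U - g (P n) \<and> g U - g (P n) \<le> \<mu> U - \<mu> (P n)" for n
    proof -
      have sub: "P n \<subseteq> U" by (auto simp: P_def U_def)
      have D: "U - P n \<in> borel_sets_on A" by (intro sets.Diff US PS)
      have "g (P n \<union> (U - P n)) = g (P n) + g (U - P n)" by (intro g_Un PS D) auto
      moreover have "P n \<union> (U - P n) = U" using sub by blast
      ultimately have "g U = g (P n) + g (U - P n)" by simp
      then show ?thesis
        using g_nonneg[OF D] g_le[OF D] signed_measure_on_Diff[OF \<mu>s US PS sub] by simp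
    qed
    have "(\<lambda>n. \<mu> (P n)) \<longlonglongrightarrow> \<mu> U"
    proof -
      have "(\<Sum>i<n. \<mu> (F i)) = \<mu> (P n)" for n
        by (rule sumP[OF signed_measure_on_empty[OF \<mu>s] signed_measure_on_Un[OF \<mu>s]])
      then show ?thesis
        using signed_measure_on_sums[OF \<mu>s FS disj] by (simp add: sums_def U_def)
    qed
    then have \<mu>lim: "(\<lambda>n. \<mu> U - \<mu> (P n)) \<longlonglongrightarrow> 0"
      using tendsto_diff[OF tendsto_const[of "\<mu> U"]] by fastforce
    have "(\<lambda>n. g U - g (P n)) \<longlonglongrightarrow> 0"
      by (rule tendsto_sandwich[OF _ _ tendsto_const \<mu>lim]) (use diff in auto)
    then have "(\<lambda>n. g U - (g U - g (P n))) \<longlonglongrightarrow> g U - 0"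
      by (rule tendsto_diff[OF tendsto_const])
    moreover have "(\<Sum>i<n. g (F i)) = g (P n)" for n
      by (rule sumP[OF g0 g_Un])
    ultimately show ?thesis by (simp add: sums_def U_def)
  qed
  then have gs: "signed_measure_on A g" using g0 by (simp add: signed_measure_on_def)
  then show "positive_measure_on A g" using g_nonneg by (simp add: positive_measure_on_def)
  show "measure_le_on A g \<mu>"
    using signed_measure_on_diff[OF \<mu>s gs] g_le
    by (simp add: measure_le_on_def positive_measure_on_def)
  show "sup_continuous_on A G"
  proof (rule sup_continuous_onI[where K = "\<mu> A"])
    fix \<phi> s assume \<phi>: "\<phi> \<in> bounded_measurable_on A" and s: "\<And>x. x \<in> A \<Longrightarrow> \<bar>\<phi> x\<bar> \<le> s"
    have m\<phi>: "(\<lambda>x. - \<phi> x) \<in> bounded_measurable_on A" by (rule function_space_minus[OF V \<phi>])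
    have "G \<phi> \<le> \<mu> A * s"
      by (rule order_trans[OF le[OF \<phi>] integral_pos_part_le[OF \<mu> \<phi> s]])
    moreover have "G (\<lambda>x. - \<phi> x) \<le> \<mu> A * s"
      by (rule order_trans[OF le[OF m\<phi>] integral_pos_part_le[OF \<mu> m\<phi>]]) (use s in simp)
    ultimately show "\<bar>G \<phi>\<bar> \<le> \<mu> A * s"
      using linear_functional_on_minus[OF G \<phi>] by simp
  qed
qed

text \<open>Since \<open>\<xi>\<close> plus its negative part is its positive part, the left-hand
  side is the integral of \<open>max 0 (\<xi> x)\<close> against \<open>f\<close>; the part of it
  against \<open>neg_part_on A f\<close> is nonnegative and enters with a minus sign.\<close>

lemma signed_integral_on_le:
  assumes f: "signed_measure_on A f" and \<xi>: "\<xi> \<in> bounded_measurable_on A"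
  shows "signed_integral_on A f \<xi> + signed_integral_on A f (\<lambda>x. max 0 (- \<xi> x))
    \<le> (LINT x|to_measure_on A (pos_part_on A f). max 0 (\<xi> x))"
proof -
  let ?V = "bounded_measurable_on A"
  note V = function_space_bounded_measurable_on[of A]
  have n: "(\<lambda>x. max 0 (- \<xi> x)) \<in> ?V"
    by (intro bounded_measurable_on_max_zero function_space_minus[OF V \<xi>])
  have "signed_integral_on A f \<xi> + signed_integral_on A f (\<lambda>x. max 0 (- \<xi> x))
      = signed_integral_on A f (\<lambda>x. \<xi> x + max 0 (- \<xi> x))"
    using linear_functional_on_add[OF linear_functional_on_signed_integral[OF f] \<xi> n] by simp
  also have "(\<lambda>x. \<xi> x + max 0 (- \<xi> x)) = (\<lambda>x. max 0 (\<xi> x))" by auto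
  finally show ?thesis by (simp add: signed_integral_on_def)
qed

section \<open>The infimal convolution and the splitting of \<open>f\<close>\<close>

theorem measure_splitting:
  fixes A \<Omega> :: "'a::metric_space set"
  assumes cpt: "compact A" and C: "0 \<le> C" and f: "signed_measure_on A f"
    and lower: "\<And>\<xi>. \<xi> \<in> Lip_vanishing \<Omega> A \<Longrightarrow> (\<forall>x\<in>A. 0 \<le> \<xi> x) \<Longrightarrow>
           signed_integral_on A f \<xi> \<ge> - C * lip_const A \<xi>"
  shows "\<exists>g. positive_measure_on A g \<and> measure_le_on A g (pos_part_on A f) \<and>
           Lip_dual_norm \<Omega> A (\<lambda>B. f B - g B) \<le> ereal C"
proof -
  let ?V = "bounded_measurable_on A" and ?L = "Lip_vanishing \<Omega> A"
  let ?T = "signed_integral_on A f"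
  define q where "q \<phi> = (LINT x|to_measure_on A (pos_part_on A f). max 0 (\<phi> x))"
    for \<phi> :: "'a \<Rightarrow> real"
  \<comment> \<open>With this \<open>k\<close>, the target bound
    \<open>?T \<xi> - G \<xi> \<le> C * lip_const A \<xi>\<close> becomes
    \<open>- G \<xi> \<le> k \<xi>\<close>.\<close>
  define k where "k \<xi> = C * lip_const A \<xi> - ?T \<xi>" for \<xi>
  note V = function_space_bounded_measurable_on[of A]
  note fp = positive_measure_on_pos_part[OF f]
  note T = linear_functional_on_signed_integral[OF f]
  have q: "sublinear_on ?V q"
    using sublinear_on_integral_pos_part[OF fp] by (simp add: q_def[abs_def])
  have LV: "\<xi> \<in> ?V" if "\<xi> \<in> ?L" for \<xi>
    by (rule Lip_vanishing_bounded_measurable_on[OF cpt that])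
  \<comment> \<open>The lower bound on integrals of nonnegative functions enters here, through the
    negative part of \<open>\<xi>\<close>. The result is the compatibility of \<open>q\<close> and
    \<open>k\<close> that keeps the infimum \<open>P\<close> finite.\<close>
  have kq: "- k \<xi> \<le> q \<xi>" if \<xi>: "\<xi> \<in> ?L" for \<xi>
  proof -
    have "- C * lip_const A (\<lambda>x. max 0 (- \<xi> x)) \<le> ?T (\<lambda>x. max 0 (- \<xi> x))"
      by (intro lower Lip_vanishing_neg_part \<xi>) auto
    moreover have "C * lip_const A (\<lambda>x. max 0 (- \<xi> x)) \<le> C * lip_const A \<xi>"
      by (intro mult_left_mono lip_const_neg_part[OF \<xi>] C)
    ultimately show ?thesis
      using signed_integral_on_le[OF f LV[OF \<xi>]] by (simp add: k_def q_def)
  qed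
  have k_add: "k (\<lambda>x. \<xi> x + \<eta> x) \<le> k \<xi> + k \<eta>" if "\<xi> \<in> ?L" "\<eta> \<in> ?L" for \<xi> \<eta>
    using linear_functional_on_add[OF T LV LV, OF that] mult_left_mono[OF lip_const_add[OF that] C]
    by (simp add: k_def algebra_simps)
  have k_scale: "k (\<lambda>x. c * \<xi> x) \<le> c * k \<xi>" if "\<xi> \<in> ?L" "0 \<le> c" for \<xi> c
    using linear_functional_on_scale[OF T LV, OF that(1)] mult_left_mono[OF lip_const_scale[OF that] C]
    by (simp add: k_def algebra_simps)
  \<comment> \<open>A linear functional is below the infimal convolution \<open>P\<close> iff it is below \<open>q\<close> and, on \<open>?L\<close>,
    \<open>?T - G\<close> is below \<open>C * lip_const A\<close>.\<close>
  define P where "P \<phi> = (INF \<xi>\<in>?L. q (\<lambda>x. \<xi> x + \<phi> x) + k \<xi>)" for \<phi>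
  have ne: "?L \<noteq> {}" using Lip_vanishing_const_zero by blast
  have P_le: "P \<phi> \<le> q (\<lambda>x. \<xi> x + \<phi> x) + k \<xi>" if \<phi>: "\<phi> \<in> ?V" and \<xi>: "\<xi> \<in> ?L" for \<phi> \<xi>
    unfolding P_def
  \<comment> \<open>The lower bound does not depend on \<open>\<xi>\<close>:
    \<open>q (\<xi> + \<phi>)\<close> is at least \<open>q \<xi> - q (- \<phi>)\<close>, and
    \<open>q \<xi> + k \<xi> \<ge> 0\<close> by \<open>kq\<close>.\<close>
  proof (rule cINF_lower[OF bdd_belowI2[where m = "- q (\<lambda>x. - \<phi> x)"] \<xi>])
    fix \<xi> assume \<xi>: "\<xi> \<in> ?L"
    show "- q (\<lambda>x. - \<phi> x) \<le> q (\<lambda>x. \<xi> x + \<phi> x) + k \<xi>"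
      using sublinear_on_lower[OF V q \<phi> LV[OF \<xi>]] kq[OF \<xi>] by (simp add: add.commute)
  qed
  have P_ge: "u \<le> P \<phi>" if "\<And>\<xi>. \<xi> \<in> ?L \<Longrightarrow> u \<le> q (\<lambda>x. \<xi> x + \<phi> x) + k \<xi>" for u \<phi>
    unfolding P_def by (rule cINF_greatest[OF ne that])
  have P: "sublinear_on ?V P"
    unfolding sublinear_on_def
  proof (intro conjI ballI allI impI)
    fix \<phi> \<psi> assume \<phi>: "\<phi> \<in> ?V" and \<psi>: "\<psi> \<in> ?V"
    \<comment> \<open>The sum \<open>\<xi> + \<eta>\<close> is the competitor for
      \<open>\<phi> + \<psi>\<close>. The two infima are then taken in turn, since
      \<open>\<xi>\<close> and \<open>\<eta>\<close> vary independently.\<close>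
    have *: "P (\<lambda>x. \<phi> x + \<psi> x) \<le> (q (\<lambda>x. \<xi> x + \<phi> x) + k \<xi>) + (q (\<lambda>x. \<eta> x + \<psi> x) + k \<eta>)"
      if \<xi>: "\<xi> \<in> ?L" and \<eta>: "\<eta> \<in> ?L" for \<xi> \<eta>
    proof -
      have "P (\<lambda>x. \<phi> x + \<psi> x) \<le> q (\<lambda>x. (\<xi> x + \<eta> x) + (\<phi> x + \<psi> x)) + k (\<lambda>x. \<xi> x + \<eta> x)"
        by (intro P_le function_space_add[OF V \<phi> \<psi>] Lip_vanishing_add \<xi> \<eta>)
      also have "(\<lambda>x. (\<xi> x + \<eta> x) + (\<phi> x + \<psi> x)) = (\<lambda>x. (\<xi> x + \<phi> x) + (\<eta> x + \<psi> x))"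
        by (simp add: algebra_simps)
      also have "q \<dots> \<le> q (\<lambda>x. \<xi> x + \<phi> x) + q (\<lambda>x. \<eta> x + \<psi> x)"
        by (intro sublinear_on_add[OF q] function_space_add[OF V] LV \<xi> \<eta> \<phi> \<psi>)
      finally show ?thesis using k_add[OF \<xi> \<eta>] by simp
    qed
    have "P (\<lambda>x. \<phi> x + \<psi> x) - (q (\<lambda>x. \<eta> x + \<psi> x) + k \<eta>) \<le> P \<phi>" if "\<eta> \<in> ?L" for \<eta>
      by (rule P_ge) (use *[OF _ that] in \<open>simp add: algebra_simps\<close>)
    then have "P (\<lambda>x. \<phi> x + \<psi> x) - P \<phi> \<le> P \<psi>"
      by (intro P_ge) (simp add: algebra_simps)
    then show "P (\<lambda>x. \<phi> x + \<psi> x) \<le> P \<phi> + P \<psi>" by simp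
  next
    fix \<phi> and c :: real assume \<phi>: "\<phi> \<in> ?V" and c: "0 < c"
    have "P (\<lambda>x. c * \<phi> x) / c \<le> P \<phi>"
    proof (rule P_ge)
      fix \<xi> assume \<xi>: "\<xi> \<in> ?L"
      have "P (\<lambda>x. c * \<phi> x) \<le> q (\<lambda>x. c * \<xi> x + c * \<phi> x) + k (\<lambda>x. c * \<xi> x)"
        using c by (intro P_le function_space_scale[OF V \<phi>] Lip_vanishing_scale \<xi>) simp
      also have "(\<lambda>x. c * \<xi> x + c * \<phi> x) = (\<lambda>x. c * (\<xi> x + \<phi> x))"
        by (simp add: algebra_simps)
      also have "q \<dots> \<le> c * q (\<lambda>x. \<xi> x + \<phi> x)"
        using c by (intro sublinear_on_scale_le[OF q] function_space_add[OF V] LV \<xi> \<phi>)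
      finally have "P (\<lambda>x. c * \<phi> x) \<le> c * (q (\<lambda>x. \<xi> x + \<phi> x) + k \<xi>)"
        using k_scale[OF \<xi>, of c] c by (simp add: algebra_simps)
      then show "P (\<lambda>x. c * \<phi> x) / c \<le> q (\<lambda>x. \<xi> x + \<phi> x) + k \<xi>"
        using c by (simp add: pos_divide_le_eq mult.commute)
    qed
    then show "P (\<lambda>x. c * \<phi> x) \<le> c * P \<phi>" using c by (simp add: pos_divide_le_eq mult.commute)
  qed
  obtain G where G: "linear_functional_on ?V G" and GP: "\<And>\<phi>. \<phi> \<in> ?V \<Longrightarrow> G \<phi> \<le> P \<phi>"
    using Hahn_Banach_sublinear[OF V P] by blast
  have Gq: "G \<phi> \<le> q \<phi>" if \<phi>: "\<phi> \<in> ?V" for \<phi>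
  proof -
    \<comment> \<open>The competitor \<open>\<xi> = 0\<close> in \<open>P\<close> costs at most 0,
      so \<open>G\<close> lies below \<open>q\<close>.\<close>
    have "k (\<lambda>_. 0) \<le> 0"
      using mult_left_mono[OF lip_const_const_zero C, of A] linear_functional_on_zero[OF V T]
      by (simp add: k_def)
    then show ?thesis
      using GP[OF \<phi>] P_le[OF \<phi> Lip_vanishing_const_zero] by simp
  qed
  have Gk: "- G \<xi> \<le> k \<xi>" if \<xi>: "\<xi> \<in> ?L" for \<xi>
  proof -
    have m: "(\<lambda>x. - \<xi> x) \<in> ?V" by (rule function_space_minus[OF V LV[OF \<xi>]])
    \<comment> \<open>Evaluating \<open>P\<close> at \<open>- \<xi>\<close> with competitor
      \<open>\<xi>\<close> cancels the argument of \<open>q\<close> and leaves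
      \<open>k \<xi>\<close>.\<close>
    have "G (\<lambda>x. - \<xi> x) \<le> q (\<lambda>_. 0) + k \<xi>"
      using GP[OF m] P_le[OF m \<xi>] by simp
    then show ?thesis
      using linear_functional_on_minus[OF G LV[OF \<xi>]] sublinear_on_zero[OF V q] by simp
  qed
  define g where "g B = G (indicator B)" for B
  have g: "positive_measure_on A g" "measure_le_on A g (pos_part_on A f)"
    and Gc: "sup_continuous_on A G"
    using dominated_functional_measure[OF fp G Gq[unfolded q_def]] by (simp_all add: g_def[abs_def])
  define h where "h B = f B - g B" for B
  have h: "signed_measure_on A h"
    unfolding h_def[abs_def] using f positive_measure_onD(1)[OF g(1)] by (rule signed_measure_on_diff)
  \<comment> \<open>The integral against \<open>h\<close> is defined by the Jordan parts of
    \<open>h\<close>, which are not the differences of those of \<open>f\<close> and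
    \<open>g\<close>. It is therefore identified with \<open>?T - G\<close> by comparing both on
    indicators.\<close>
  have eq: "signed_integral_on A h \<phi> - (?T \<phi> - G \<phi>) = 0" if "\<phi> \<in> ?V" for \<phi>
  proof (rule linear_functional_on_eq_zero[OF _ _ _ that])
    show "linear_functional_on ?V (\<lambda>\<phi>. signed_integral_on A h \<phi> - (?T \<phi> - G \<phi>))"
      by (intro linear_functional_on_diff linear_functional_on_signed_integral h f G)
    show "sup_continuous_on A (\<lambda>\<phi>. signed_integral_on A h \<phi> - (?T \<phi> - G \<phi>))"
      by (intro sup_continuous_on_diff sup_continuous_on_signed_integral h f Gc)
    show "signed_integral_on A h (indicator B) - (?T (indicator B) - G (indicator B)) = 0"
      if "B \<in> borel_sets_on A" for B
      using signed_integral_on_indicator[OF h that] signed_integral_on_indicator[OF f that]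
      by (simp add: h_def g_def)
  qed
  \<comment> \<open>By \<open>eq\<close> and \<open>Gk\<close> the integral is at most
    \<open>C * lip_const A \<xi>\<close>, hence at most \<open>C\<close> as
    \<open>0 \<le> C\<close>.\<close>
  have "signed_integral_on A h \<xi> \<le> C" if "\<xi> \<in> ?L" "lip_const A \<xi> \<le> 1" for \<xi>
    using eq[OF LV[OF that(1)]] Gk[OF that(1)] mult_left_mono[OF that(2) C] by (simp add: k_def)
  then have "Lip_dual_norm \<Omega> A (\<lambda>B. f B - g B) \<le> ereal C"
    unfolding Lip_dual_norm_def h_def[abs_def, symmetric] by (intro SUP_least) auto
  with g show ?thesis by blast
qed

theorem lemma0p1:
  fixes A \<Omega> :: "(real ^ 2) set" and C\<^sub>0 :: real and f :: "(real ^ 2) set \<Rightarrow> real"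
  assumes "compact A" and "open \<Omega>" and "0 \<le> C\<^sub>0"
    and "signed_measure_on A f"
    and "\<And>\<xi>. \<xi> \<in> Lip_vanishing \<Omega> A \<Longrightarrow> (\<forall>x\<in>A. 0 \<le> \<xi> x) \<Longrightarrow>
           signed_integral_on A f \<xi> \<ge> - C\<^sub>0 * lip_const A \<xi>"
  shows "\<exists>g :: (real ^ 2) set \<Rightarrow> real.
           signed_measure_on A g \<and>
           measure_le_on A (\<lambda>_. 0) g \<and> measure_le_on A g (pos_part_on A f) \<and>
           Lip_dual_norm \<Omega> A (\<lambda>B. f B - g B) \<le> ereal C\<^sub>0"
proof -
  obtain g where "positive_measure_on A g" "measure_le_on A g (pos_part_on A f)"
    "Lip_dual_norm \<Omega> A (\<lambda>B. f B - g B) \<le> ereal C\<^sub>0"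
    using measure_splitting[OF assms(1,3,4,5)] by blast
  then show ?thesis
    by (intro exI[of _ g]) (simp add: measure_le_on_def positive_measure_onD(1))
qed

end
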